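(* Let $k\geq3$, $m$, $d\geq2$ be integers with $1\leq m<k/2$, and let $(a_1,\dots,a_p)$ be an integer tuple with $0\leq a_1<\cdots<a_p\leq d-2$. Let $n=kd-1$, $v=md-1$, $w=(k-m)d-1$, and for $(i,j)\in\{1,\dots,k\}\times\{1,\dots,p\}$ let $u_{(i,j)}=(i-1)d+a_j$. Let $P_n$ be the path on $n$ vertices labeled $0,1,\dots,n-1$ in order along the path. Then for any rooted graph $G$ with root $r$, the multiple coalescences $$P_n(v\!=\!r)G(u_{(1,1)}\!=\!r)G(u_{(1,2)}\!=\!r)G\cdots(u_{(k,p)}\!=\!r)G$$ and $$P_n(w\!=\!r)G(u_{(1,1)}\!=\!r)G(u_{(1,2)}\!=\!r)G\cdots(u_{(k,p)}\!=\!r)G$$ are cospectral.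
   Context: Two graphs are cospectral if their adjacency matrices have the same characteristic polynomial. For a graph $T$ with distinct vertices $x_1,\dots,x_s$ and a rooted graph $G$ with root $r$, the multiple coalescence $T(x_1\!=\!r)G\cdots(x_s\!=\!r)G$ is the graph obtained from the disjoint union of $T$ and $s$ separate copies of $G$ by identifying $x_i$ with the root of the $i$-th copy of $G$, for each $i$ (so exactly one copy of $G$ is attached at each listed vertex). *)

theory Defs
  imports "Graph_Theory.Pair_Digraph" "Jordan_Normal_Form.Char_Poly"
begin

text \<open>
  A finite simple graph is a \<^locale>\<open>pair_graph\<close>: finite, loopfree, and with a symmetric set
  of arcs, so that an edge is represented by its two arcs of opposite direction.
\<close>

definition path_graph :: "nat \<Rightarrow> nat pair_pre_digraph" where
  "path_graph n =
     \<lparr> pverts = {..<n}, parcs = {(i, j). i < n \<and> j < n \<and> (j = Suc i \<or> i = Suc j)} \<rparr>"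

text \<open>
  The vertices of the disjoint union of \<open>T\<close> and \<open>s\<close> copies of \<open>G\<close> are \<open>Inl t\<close> for the
  vertices \<open>t\<close> of \<open>T\<close>, and \<open>Inr (i, g)\<close> for the copy of \<open>g\<close> in the \<open>i\<close>-th copy of \<open>G\<close>,
  where \<open>i < s\<close>.
\<close>

definition disjoint_union_copies ::
  "'a pair_pre_digraph \<Rightarrow> nat \<Rightarrow> 'b pair_pre_digraph \<Rightarrow> ('a + nat \<times> 'b) pair_pre_digraph" where
  "disjoint_union_copies T s G =
     \<lparr> pverts = Inl ` pverts T \<union> {Inr (i, g) | i g. i < s \<and> g \<in> pverts G},
       parcs = {(Inl t, Inl t') | t t'. (t, t') \<in> parcs T} \<union>
               {(Inr (i, g), Inr (i, g')) | i g g'. i < s \<and> (g, g') \<in> parcs G} \<rparr>"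

text \<open>
  The quotient map of the identification: the root of the \<open>i\<close>-th copy of \<open>G\<close> is sent to the
  \<open>i\<close>-th entry of \<open>xs\<close>, which serves as the representative of its class, and every other vertex
  is sent to itself.
\<close>

definition identify_root :: "'a list \<Rightarrow> 'b \<Rightarrow> 'a + nat \<times> 'b \<Rightarrow> 'a + nat \<times> 'b" where
  "identify_root xs r z =
     (case z of Inl t \<Rightarrow> Inl t | Inr (i, g) \<Rightarrow> (if g = r then Inl (xs ! i) else Inr (i, g)))"

definition coalescence ::
  "'a pair_pre_digraph \<Rightarrow> 'a list \<Rightarrow> 'b pair_pre_digraph \<Rightarrow> 'b \<Rightarrow> ('a + nat \<times> 'b) pair_pre_digraph"
  where
  "coalescence T xs G r =
     (let U = disjoint_union_copies T (length xs) G; q = identify_root xs r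
      in \<lparr> pverts = q ` pverts U, parcs = map_prod q q ` parcs U \<rparr>)"

definition adjacency_matrix :: "'a pair_pre_digraph \<Rightarrow> 'a list \<Rightarrow> real mat" where
  "adjacency_matrix G vs =
     mat (length vs) (length vs) (\<lambda>(i, j). if (vs ! i, vs ! j) \<in> parcs G then 1 else 0)"

text \<open>
  The adjacency matrix depends on an enumeration of the vertices, its characteristic polynomial
  does not. The finiteness conditions ensure that enumerations exist.
\<close>

definition cospectral :: "'a pair_pre_digraph \<Rightarrow> 'b pair_pre_digraph \<Rightarrow> bool" where
  "cospectral G H \<longleftrightarrow> finite (pverts G) \<and> finite (pverts H) \<and>
     (\<forall>vs ws. distinct vs \<and> set vs = pverts G \<and> distinct ws \<and> set ws = pverts H \<longrightarrow>
        char_poly (adjacency_matrix G vs) = char_poly (adjacency_matrix H ws))"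

lemma pair_graph_path_graph: "pair_graph (path_graph n)"
proof
  show "finite (parcs (path_graph n))"
    by (rule finite_subset[of _ "{..<n} \<times> {..<n}"]) (auto simp: path_graph_def)
qed (auto simp: path_graph_def arc_to_ends_def symmetric_def intro!: symI)

lemma pair_graph_coalescence:
  assumes "pair_graph T" "pair_graph G" "set xs \<subseteq> pverts T" "r \<in> pverts G"
  shows "pair_graph (coalescence T xs G r)"
proof -
  interpret T: pair_graph T by fact
  interpret G: pair_graph G by fact
  let ?U = "disjoint_union_copies T (length xs) G"
  let ?C = "coalescence T xs G r"
  have symT: "(b, a) \<in> parcs T" if "(a, b) \<in> parcs T" for a b
    using T.pair_sym_arcs that by (auto simp: symmetric_def dest: symD)
  have symG: "(b, a) \<in> parcs G" if "(a, b) \<in> parcs G" for a b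
    using G.pair_sym_arcs that by (auto simp: symmetric_def dest: symD)
  have V: "pverts ?C = identify_root xs r ` pverts ?U"
    and A: "parcs ?C = map_prod (identify_root xs r) (identify_root xs r) ` parcs ?U"
    by (simp_all add: coalescence_def Let_def)
  have "{Inr (i, g) | i g. i < length xs \<and> g \<in> pverts G}
      = (Inr ` ({..<length xs} \<times> pverts G) :: ('a + nat \<times> 'b) set)"
    by auto
  then have "finite (pverts ?U)"
    by (simp add: disjoint_union_copies_def T.pair_finite_verts G.pair_finite_verts)
  then have fin: "finite (pverts ?C)" by (simp add: V)
  have UA: "a \<in> pverts ?U \<and> b \<in> pverts ?U" if "(a, b) \<in> parcs ?U" for a b
    using that by (auto simp: disjoint_union_copies_def
        dest: T.in_arcsD1 T.in_arcsD2 G.in_arcsD1 G.in_arcsD2)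
  have ends: "a \<in> pverts ?C \<and> b \<in> pverts ?C" if "(a, b) \<in> parcs ?C" for a b
    using that UA by (auto simp: A V)
  have USym: "(b, a) \<in> parcs ?U" if "(a, b) \<in> parcs ?U" for a b
    using that by (auto simp: disjoint_union_copies_def intro: symT symG)
  have sym: "(b, a) \<in> parcs ?C" if "(a, b) \<in> parcs ?C" for a b
    using that USym unfolding A by force
  have loop: "a \<noteq> b" if "(a, b) \<in> parcs ?C" for a b
    using that T.pair_no_loops G.pair_no_loops
    by (fastforce simp: A disjoint_union_copies_def identify_root_def split: if_splits)
  show ?thesis
  proof
    show "finite (parcs ?C)"
      by (rule finite_subset[of _ "pverts ?C \<times> pverts ?C"]) (use ends fin in auto)
    show "symmetric ?C"
      using sym by (auto simp: symmetric_def intro!: symI)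
  qed (use ends fin loop in auto)
qed

end

theory Submission
  imports Defs
begin

text \<open>
  Let \<open>H\<close> be the path with the copies of \<open>G\<close> at all \<open>u i j\<close>. Expanding the characteristic
  polynomial at the cut vertex \<open>v\<close> of \<open>H(v=r)G\<close> shows that it depends on \<open>v\<close> only through the
  characteristic polynomial of \<open>H - v\<close>. The vertices \<open>i * d - 1\<close> cut \<open>H\<close> into \<open>k\<close> isomorphic
  blocks, so \<open>H - v\<close> consists of a chain of \<open>m\<close> blocks and a chain of \<open>k - m\<close> blocks, and \<open>H - w\<close>
  of the same two chains in the opposite order. Hence \<open>H - v\<close> and \<open>H - w\<close> are isomorphic.
\<close>

section \<open>Determinants of matrices indexed by lists\<close>

text \<open>Indexing by entries instead of positions turns principal submatrices into sublists, with
  no numbering of the vertices to carry along.\<close>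

definition idx_det :: "'a list \<Rightarrow> ('a \<Rightarrow> 'a \<Rightarrow> 'c::comm_ring_1) \<Rightarrow> 'c" where
  "idx_det xs f = det (mat (length xs) (length xs) (\<lambda>(i, j). f (xs ! i) (xs ! j)))"

lemma idx_det_map: "idx_det (map h xs) f = idx_det xs (\<lambda>x y. f (h x) (h y))"
  unfolding idx_det_def by (intro arg_cong[where f = det] eq_matI) auto

lemma idx_det_cong:
  assumes "\<And>x y. x \<in> set xs \<Longrightarrow> y \<in> set xs \<Longrightarrow> f x y = g x y"
  shows "idx_det xs f = idx_det xs g"
  unfolding idx_det_def using assms by (intro arg_cong[where f = det] eq_matI) auto

text \<open>Permuting the rows and, through the transpose, the columns each gives a factor
  \<open>signof p\<close>; the two signs cancel.\<close>

lemma det_permute_rows_cols: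
  assumes p: "p permutes {0..<n}"
  shows "det (mat n n (\<lambda>(i, j). f (p i) (p j))) = det (mat n n (\<lambda>(i, j). f i j))"
proof -
  have less: "p i < n" if "i < n" for i
    using permutes_in_image[OF p, of i] that by simp
  let ?A = "mat n n (\<lambda>(i, j). f i j)"
  let ?B = "mat n n (\<lambda>(i, j). f j (p i))"
  have "mat n n (\<lambda>(i, j). f (p i) (p j)) = mat n n (\<lambda>(i, j). transpose_mat ?B $$ (p i, j))"
    by (rule eq_matI) (auto simp: less)
  then have "det (mat n n (\<lambda>(i, j). f (p i) (p j))) = signof p * det (transpose_mat ?B)"
    using det_permute_rows[OF _ p, of "transpose_mat ?B"] by simp
  also have "det (transpose_mat ?B) = det ?B"
    by (rule det_transpose[of _ n]) simp
  also have "?B = mat n n (\<lambda>(i, j). transpose_mat ?A $$ (p i, j))"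
    by (rule eq_matI) (auto simp: less)
  also have "det \<dots> = signof p * det (transpose_mat ?A)"
    by (rule det_permute_rows[OF _ p]) simp
  also have "det (transpose_mat ?A) = det ?A"
    by (rule det_transpose[of _ n]) simp
  finally show ?thesis
    by (simp add: sign_def)
qed

text \<open>Reordering the list permutes rows and columns simultaneously, so for distinct entries
  only the underlying set matters.\<close>

lemma idx_det_perm:
  assumes "mset xs = mset ys"
  shows "idx_det xs f = idx_det ys f"
proof -
  obtain p where p: "p permutes {..<length ys}" and xs: "permute_list p ys = xs"
    using mset_eq_permutation[OF assms] .
  have len: "length xs = length ys"
    using assms by (rule mset_eq_length)
  have p': "p permutes {0..<length ys}"
    using p by (simp add: atLeast0LessThan)
  have "idx_det xs f = det (mat (length ys) (length ys) (\<lambda>(i, j). f (ys ! p i) (ys ! p j)))"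
    unfolding idx_det_def len
    by (intro arg_cong[where f = det] eq_matI) (auto simp flip: xs simp: permute_list_nth[OF p])
  also have "\<dots> = idx_det ys f"
    unfolding idx_det_def by (rule det_permute_rows_cols[OF p', of "\<lambda>i j. f (ys ! i) (ys ! j)"])
  finally show ?thesis .
qed

text \<open>The matrix is block lower triangular. The other off-diagonal block stays arbitrary
  because the column of a cut vertex meets both sides.\<close>

lemma idx_det_append:
  fixes f :: "'a \<Rightarrow> 'a \<Rightarrow> 'c::idom"
  assumes "\<And>x y. x \<in> set xs \<Longrightarrow> y \<in> set ys \<Longrightarrow> f x y = 0"
  shows "idx_det (xs @ ys) f = idx_det xs f * idx_det ys f"
proof -
  let ?n = "length xs" and ?m = "length ys"
  let ?A = "mat ?n ?n (\<lambda>(i, j). f (xs ! i) (xs ! j))"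
  let ?C = "mat ?m ?n (\<lambda>(i, j). f (ys ! i) (xs ! j))"
  let ?D = "mat ?m ?m (\<lambda>(i, j). f (ys ! i) (ys ! j))"
  have "mat (length (xs @ ys)) (length (xs @ ys)) (\<lambda>(i, j). f ((xs @ ys) ! i) ((xs @ ys) ! j)) =
      four_block_mat ?A (0\<^sub>m ?n ?m) ?C ?D"
    using assms by (intro eq_matI) (auto simp: nth_append)
  then show ?thesis
    unfolding idx_det_def
    using det_four_block_mat_upper_right_zero[of ?A ?n "0\<^sub>m ?n ?m" ?m ?C ?D] by simp
qed

text \<open>Linearity of the determinant in the row of \<open>z\<close>, by Laplace expansion along
  row 0: the cofactors omit that row, so \<open>f\<close>, \<open>g\<close> and \<open>h\<close>
  share them.\<close>

lemma idx_det_row_add: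
  assumes "z \<notin> set xs"
    and "\<And>y. f z y = g z y + h z y"
    and "\<And>x y. x \<in> set xs \<Longrightarrow> g x y = f x y" "\<And>x y. x \<in> set xs \<Longrightarrow> h x y = f x y"
  shows "idx_det (z # xs) f = idx_det (z # xs) g + idx_det (z # xs) h"
proof -
  let ?n = "Suc (length xs)"
  let ?M = "\<lambda>f. mat ?n ?n (\<lambda>(i, j). f ((z # xs) ! i) ((z # xs) ! j))"
  have cof: "cofactor (?M f') 0 j = cofactor (?M f) 0 j"
    if "\<And>x y. x \<in> set xs \<Longrightarrow> f' x y = f x y" for f' j
    unfolding cofactor_def mat_delete_def using that
    by (intro arg_cong2[where f = "(*)"] arg_cong[where f = det] eq_matI refl) auto
  have laplace: "idx_det (z # xs) f' = (\<Sum>j<?n. f' z ((z # xs) ! j) * cofactor (?M f) 0 j)"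
    if "\<And>x y. x \<in> set xs \<Longrightarrow> f' x y = f x y" for f'
    unfolding idx_det_def using laplace_expansion_row[of "?M f'" ?n 0] cof[OF that]
    by simp
  have "idx_det (z # xs) f = (\<Sum>j<?n. (g z ((z # xs) ! j) + h z ((z # xs) ! j)) * cofactor (?M f) 0 j)"
    unfolding laplace[of f, OF refl] assms(2) ..
  also have "\<dots> = (\<Sum>j<?n. g z ((z # xs) ! j) * cofactor (?M f) 0 j) +
      (\<Sum>j<?n. h z ((z # xs) ! j) * cofactor (?M f) 0 j)"
    unfolding distrib_right by (rule sum.distrib)
  also have "\<dots> = idx_det (z # xs) g + idx_det (z # xs) h"
    using assms(3,4) by (intro arg_cong2[where f = "(+)"] laplace[symmetric])
  finally show ?thesis .
qed

text \<open>
  Row \<open>z\<close> is the sum of its restriction to \<open>z # xs\<close> and its restriction to \<open>ys\<close>; each of the two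
  resulting matrices is block triangular.
\<close>

lemma idx_det_cut_vertex:
  fixes f :: "'a \<Rightarrow> 'a \<Rightarrow> 'c::idom"
  assumes zero: "\<And>x y. x \<in> set xs \<Longrightarrow> y \<in> set ys \<Longrightarrow> f x y = 0 \<and> f y x = 0"
    and dist: "distinct (z # xs @ ys)"
  shows "idx_det (z # xs @ ys) f =
    idx_det (z # xs) f * idx_det ys f +
    idx_det xs f * idx_det (z # ys) (\<lambda>x y. if x = z \<and> y = z then 0 else f x y)"
proof -
  define g where "g x y = (if x = z \<and> y \<in> set ys then 0 else f x y)" for x y
  define h where "h x y = (if x = z \<and> y \<notin> set ys then 0 else f x y)" for x y
  have "idx_det (z # xs @ ys) f = idx_det (z # xs @ ys) g + idx_det (z # xs @ ys) h"
    by (rule idx_det_row_add) (use dist in \<open>auto simp: g_def h_def\<close>)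
  also have "idx_det (z # xs @ ys) g = idx_det (z # xs) g * idx_det ys g"
    unfolding append_Cons[symmetric] by (rule idx_det_append) (use zero in \<open>auto simp: g_def\<close>)
  also have "idx_det (z # xs) g = idx_det (z # xs) f"
    by (rule idx_det_cong) (use dist in \<open>auto simp: g_def\<close>)
  also have "idx_det ys g = idx_det ys f"
    by (rule idx_det_cong) (use dist in \<open>auto simp: g_def\<close>)
  \<comment> \<open>In \<open>h\<close> the row of \<open>z\<close> is supported on
    \<open>ys\<close>, so \<open>z\<close> joins the block of \<open>ys\<close>. Its diagonal entry
    went to \<open>g\<close>, whence the 0 at \<open>(z, z)\<close>.\<close>
  also have "idx_det (z # xs @ ys) h = idx_det ((z # ys) @ xs) h"
    by (rule idx_det_perm) simp
  also have "\<dots> = idx_det (z # ys) h * idx_det xs h"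
    by (rule idx_det_append) (use zero dist in \<open>auto simp: h_def\<close>)
  also have "idx_det (z # ys) h = idx_det (z # ys) (\<lambda>x y. if x = z \<and> y = z then 0 else f x y)"
    by (rule idx_det_cong) (use dist in \<open>auto simp: h_def\<close>)
  also have "idx_det xs h = idx_det xs f"
    by (rule idx_det_cong) (use dist in \<open>auto simp: h_def\<close>)
  finally show ?thesis
    by (simp add: mult.commute)
qed

section \<open>Characteristic polynomials as indexed determinants\<close>

text \<open>The entry of \<open>X I - A\<close> at a pair of vertices, with \<open>[:0, 1:]\<close>
  as \<open>X\<close>. On a distinct list, \<open>idx_det\<close> of it is the characteristic
  polynomial of the induced subgraph.\<close>

definition char_entry :: "('a \<times> 'a) set \<Rightarrow> 'a \<Rightarrow> 'a \<Rightarrow> real poly" where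
  "char_entry E x y = (if x = y then [:0, 1:] else 0) - (if (x, y) \<in> E then 1 else 0)"

lemma char_poly_adjacency_matrix:
  assumes "distinct vs"
  shows "char_poly (adjacency_matrix G vs) = idx_det vs (char_entry (parcs G))"
  unfolding idx_det_def char_poly_def
  by (intro arg_cong[where f = det] eq_matI)
    (use assms in \<open>auto simp: char_poly_matrix_def adjacency_matrix_def char_entry_def
      nth_eq_iff_index_eq one_pCons\<close>)

text \<open>Isomorphism invariance for induced subgraphs: \<open>ys\<close> is a reordering of
  \<open>map h xs\<close>.\<close>

lemma idx_det_char_entry_bij:
  assumes bij: "bij_betw h (set xs) (set ys)" and "distinct xs" "distinct ys"
    and arcs: "\<And>x y. x \<in> set xs \<Longrightarrow> y \<in> set xs \<Longrightarrow> (h x, h y) \<in> F \<longleftrightarrow> (x, y) \<in> E"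
  shows "idx_det ys (char_entry F) = idx_det xs (char_entry E)"
proof -
  have inj: "inj_on h (set xs)" and "set (map h xs) = set ys"
    using bij by (auto simp: bij_betw_def)
  then have "mset ys = mset (map h xs)"
    using assms(2,3) set_eq_iff_mset_eq_distinct[of ys "map h xs"] by (simp add: distinct_map)
  then have "idx_det ys (char_entry F) = idx_det (map h xs) (char_entry F)"
    by (rule idx_det_perm)
  also have "\<dots> = idx_det xs (char_entry E)"
    unfolding idx_det_map
    by (rule idx_det_cong) (auto simp: char_entry_def arcs inj_on_eq_iff[OF inj])
  finally show ?thesis .
qed

section \<open>Vertices and arcs of a coalescence\<close>

text \<open>The roots contribute nothing new: each is sent to an entry of \<open>xs\<close>, already
  a vertex of \<open>T\<close>.\<close>

lemma pverts_coalescence: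
  fixes T :: "'a pair_pre_digraph" and G :: "'b pair_pre_digraph"
  assumes "r \<in> pverts G" "set xs \<subseteq> pverts T"
  shows "pverts (coalescence T xs G r) =
    Inl ` pverts T \<union> Inr ` ({..<length xs} \<times> (pverts G - {r}))"
proof -
  let ?q = "identify_root xs r" and ?I = "{..<length xs}"
  have "pverts (coalescence T xs G r) = ?q ` Inl ` pverts T \<union> ?q ` Inr ` (?I \<times> pverts G)"
  proof -
    have "{Inr (i, g) | i g. i < length xs \<and> g \<in> pverts G} =
        (Inr ` (?I \<times> pverts G) :: ('a + nat \<times> 'b) set)"
      by auto
    then show ?thesis
      by (simp add: coalescence_def disjoint_union_copies_def Let_def image_Un)
  qed
  also have "?q ` Inl ` pverts T = Inl ` pverts T"
    by (simp add: image_image identify_root_def)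
  also have "pverts G = insert r (pverts G - {r})"
    using assms(1) by auto
  also have "?I \<times> \<dots> = ?I \<times> {r} \<union> ?I \<times> (pverts G - {r})"
    by auto
  also have "?q ` Inr ` \<dots> = ?q ` Inr ` (?I \<times> {r}) \<union> ?q ` Inr ` (?I \<times> (pverts G - {r}))"
    by (simp only: image_Un)
  also have "?q ` Inr ` (?I \<times> (pverts G - {r})) = Inr ` (?I \<times> (pverts G - {r}))"
    unfolding image_image
  proof (rule image_cong[OF refl])
    fix z assume "z \<in> ?I \<times> (pverts G - {r})"
    then show "?q (Inr z) = Inr z"
      by (cases z) (simp add: identify_root_def)
  qed
  finally have "pverts (coalescence T xs G r) = Inl ` pverts T \<union>
      (?q ` Inr ` (?I \<times> {r}) \<union> Inr ` (?I \<times> (pverts G - {r})))" .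
  moreover have "?q ` Inr ` (?I \<times> {r}) \<subseteq> Inl ` pverts T"
    by (auto simp: identify_root_def intro!: imageI subsetD[OF assms(2)])
  ultimately show ?thesis
    by blast
qed

text \<open>A loop at \<open>r\<close> would reappear at every attachment vertex; excluding it
  leaves only the arcs of \<open>T\<close>.\<close>

lemma Inl_Inl_in_coalescence:
  assumes "(r, r) \<notin> parcs G"
  shows "(Inl x, Inl y) \<in> parcs (coalescence T xs G r) \<longleftrightarrow> (x, y) \<in> parcs T"
  using assms unfolding coalescence_def disjoint_union_copies_def Let_def
  by (force simp: identify_root_def image_iff split: if_splits)

lemma Inl_Inr_in_coalescence:
  "(Inl x, Inr (i, g)) \<in> parcs (coalescence T xs G r) \<longleftrightarrow>
    i < length xs \<and> x = xs ! i \<and> g \<noteq> r \<and> (r, g) \<in> parcs G"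
  unfolding coalescence_def disjoint_union_copies_def Let_def
  by (force simp: identify_root_def image_iff split: if_splits)

lemma Inr_Inl_in_coalescence:
  "(Inr (i, g), Inl x) \<in> parcs (coalescence T xs G r) \<longleftrightarrow>
    i < length xs \<and> x = xs ! i \<and> g \<noteq> r \<and> (g, r) \<in> parcs G"
  unfolding coalescence_def disjoint_union_copies_def Let_def
  by (force simp: identify_root_def image_iff split: if_splits)

lemma Inr_Inr_in_coalescence:
  "(Inr (i, g), Inr (j, h)) \<in> parcs (coalescence T xs G r) \<longleftrightarrow>
    i < length xs \<and> i = j \<and> g \<noteq> r \<and> h \<noteq> r \<and> (g, h) \<in> parcs G"
  unfolding coalescence_def disjoint_union_copies_def Let_def
  by (force simp: identify_root_def image_iff split: if_splits)

lemmas in_coalescence =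
  Inl_Inl_in_coalescence Inl_Inr_in_coalescence Inr_Inl_in_coalescence Inr_Inr_in_coalescence

section \<open>Moving one copy of the rooted graph to another attachment vertex\<close>

text \<open>Of the factors in the cut vertex expansion, only the one for the graph without the cut
  vertex needs \<open>\<sigma>\<close>: it permutes \<open>us\<close>, so it extends to the copies
  attached there.\<close>

theorem cospectral_coalescence_Cons:
  fixes T :: "'a pair_pre_digraph" and G :: "'b pair_pre_digraph"
  assumes "pair_graph T" "pair_graph G" and r: "r \<in> pverts G"
    and v: "v \<in> pverts T" and w: "w \<in> pverts T"
    and us: "distinct us" "set us \<subseteq> pverts T - {v, w}"
    and bij: "bij_betw \<sigma> (pverts T - {v}) (pverts T - {w})"
    and arcs: "\<And>x y. x \<in> pverts T - {v} \<Longrightarrow> y \<in> pverts T - {v} \<Longrightarrow>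
      (\<sigma> x, \<sigma> y) \<in> parcs T \<longleftrightarrow> (x, y) \<in> parcs T"
    and \<sigma>_us: "\<sigma> ` set us \<subseteq> set us"
  shows "cospectral (coalescence T (v # us) G r) (coalescence T (w # us) G r)"
proof -
  interpret T: pair_graph T by fact
  interpret G: pair_graph G by fact
  have no_loop: "(r, r) \<notin> parcs G"
    using G.pair_no_loops[of "(r, r)"] by auto
  note in_coal = in_coalescence(1)[OF no_loop] in_coalescence(2-)
  let ?C = "\<lambda>x. coalescence T (x # us) G r"
  let ?M = "\<lambda>x. char_entry (parcs (?C x))"
  let ?N = "\<lambda>x y z. if y = Inl x \<and> z = Inl x then 0 else ?M x y z"
  let ?L = "length us"
  let ?R = "pverts G - {r}"
  \<comment> \<open>The vertices other than \<open>x\<close> of \<open>T\<close> with copies at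
    \<open>us\<close> only. Copy 0 hangs at \<open>x\<close>, so the copies at \<open>us\<close>
    have the indices \<open>Suc i\<close>.\<close>
  define rest where "rest x = Inl ` (pverts T - {x}) \<union> Inr ` (Suc ` {..<?L} \<times> ?R)" for x
  have fin_rest: "finite (rest x)" for x
    by (simp add: rest_def T.pair_finite_verts G.pair_finite_verts)
  have pverts: "pverts (?C x) = insert (Inl x) (rest x \<union> Inr ` ({0} \<times> ?R))"
    if "x \<in> pverts T" for x
  proof -
    have "{..<length (x # us)} \<times> ?R = {0} \<times> ?R \<union> Suc ` {..<?L} \<times> ?R"
      by (auto simp: lessThan_Suc_eq_insert_0)
    moreover have "(Inl ` pverts T :: ('a + nat \<times> 'b) set) = insert (Inl x) (Inl ` (pverts T - {x}))"
      using that by auto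
    moreover have "set (x # us) \<subseteq> pverts T"
      using us that by auto
    ultimately show ?thesis
      unfolding pverts_coalescence[OF r \<open>set (x # us) \<subseteq> pverts T\<close>] by (simp only: rest_def image_Un Un_insert_left Un_ac)
  qed
  obtain hv where hv: "set hv = rest v" "distinct hv"
    using finite_distinct_list[OF fin_rest] by blast
  obtain hw where hw: "set hw = rest w" "distinct hw"
    using finite_distinct_list[OF fin_rest] by blast
  obtain gs :: "('a + nat \<times> 'b) list" where gs: "set gs = Inr ` ({0} \<times> ?R)" "distinct gs"
    using finite_distinct_list[of "Inr ` ({0} \<times> ?R)"] G.pair_finite_verts by blast
  have expand: "char_poly (adjacency_matrix (?C x) vs) =
      idx_det (Inl x # hs) (?M x) * idx_det gs (?M x) + idx_det hs (?M x) * idx_det (Inl x # gs) (?N x)"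
    if "x \<in> pverts T" "set hs = rest x" "distinct hs" "distinct vs" "set vs = pverts (?C x)"
    for x vs hs
  proof -
    have dist: "distinct (Inl x # hs @ gs)"
      using that gs by (auto simp: rest_def)
    have "set vs = set (Inl x # hs @ gs)"
      using pverts that gs by auto
    then have "mset vs = mset (Inl x # hs @ gs)"
      using dist that set_eq_iff_mset_eq_distinct by blast
    then have "char_poly (adjacency_matrix (?C x) vs) = idx_det (Inl x # hs @ gs) (?M x)"
      using char_poly_adjacency_matrix[OF \<open>distinct vs\<close>] idx_det_perm by metis
    also have "\<dots> = idx_det (Inl x # hs) (?M x) * idx_det gs (?M x) +
        idx_det hs (?M x) * idx_det (Inl x # gs) (?N x)"
      \<comment> \<open>Copy 0 is joined to the rest only through \<open>Inl x\<close>, so no arc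
        runs between \<open>hs\<close> and \<open>gs\<close>.\<close>
      by (rule idx_det_cut_vertex[OF _ dist])
        (auto simp: that gs rest_def char_entry_def in_coal)
    finally show ?thesis .
  qed

  have with_root: "idx_det (Inl v # hv) (?M v) = idx_det (Inl w # hw) (?M w)"
  proof -
    \<comment> \<open>Putting the cut vertex back gives the same graph for \<open>v\<close> and
      \<open>w\<close>, so the identity is an isomorphism.\<close>
    have "set (Inl v # hv) = set (Inl w # hw)"
      using v w by (auto simp: hv hw rest_def)
    then have "bij_betw id (set (Inl v # hv)) (set (Inl w # hw))"
      by simp
    moreover have "distinct (Inl v # hv)" "distinct (Inl w # hw)"
      using hv hw by (auto simp: rest_def)
    ultimately show ?thesis
      by (intro idx_det_char_entry_bij[symmetric])
        (auto simp: hv rest_def in_coal)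
  qed
  have copy: "idx_det gs (?M v) = idx_det gs (?M w)"
    by (rule idx_det_cong) (auto simp: gs char_entry_def in_coal)
  have copy_root: "idx_det (Inl v # gs) (?N v) = idx_det (Inl w # gs) (?N w)"
  proof -
    \<comment> \<open>A renaming of the root that fixes the copy. \<open>?N\<close> has a zeroed
      diagonal entry and is no \<open>char_entry\<close>, so \<open>idx_det_map\<close> is applied
      directly.\<close>
    define h where "h = case_sum (\<lambda>_ :: 'a. Inl w) (Inr :: nat \<times> 'b \<Rightarrow> 'a + nat \<times> 'b)"
    have "Inl w # gs = map h (Inl v # gs)"
      using gs by (auto simp: h_def intro!: map_idI[symmetric])
    then have "idx_det (Inl w # gs) (?N w) =
        idx_det (Inl v # gs) (\<lambda>x y. ?N w (h x) (h y))"
      by (simp only: idx_det_map)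
    also have "\<dots> = idx_det (Inl v # gs) (?N v)"
      by (rule idx_det_cong) (auto simp: gs char_entry_def in_coal h_def)
    finally show ?thesis ..
  qed
  have without_root: "idx_det hw (?M w) = idx_det hv (?M v)"
  proof -
    have us_v: "set us \<subseteq> pverts T - {v}"
      using us by auto
    have inj: "inj_on \<sigma> (pverts T - {v})" and img: "\<sigma> ` (pverts T - {v}) = pverts T - {w}"
      using bij by (auto simp: bij_betw_def)
    have "inj_on \<sigma> (set us)"
      using inj us_v by (rule inj_on_subset)
    \<comment> \<open>An injective map of a finite set into itself is onto.\<close>
    then have \<sigma>: "bij_betw \<sigma> (set us) (set us)"
      using \<sigma>_us by (simp add: bij_betw_def endo_inj_surj)
    have nth: "bij_betw (nth us) {..<?L} (set us)"
      by (rule bij_betw_nth) (simp_all add: us)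
    \<comment> \<open>The permutation of copy indices induced by \<open>\<sigma>\<close>: the copy
      at \<open>us ! i\<close> must go to the copy at \<open>\<sigma> (us ! i)\<close>.\<close>
    define \<tau> where "\<tau> = inv_into {..<?L} (nth us) \<circ> (\<sigma> \<circ> nth us)"
    have \<tau>: "bij_betw \<tau> {..<?L} {..<?L}"
      unfolding \<tau>_def using nth \<sigma> by (intro bij_betw_trans bij_betw_inv_into) auto
    have nth_\<tau>: "us ! \<tau> i = \<sigma> (us ! i)" if "i < ?L" for i
    proof -
      have "\<sigma> (us ! i) \<in> nth us ` {..<?L}"
        using \<sigma>_us nth that by (auto simp: bij_betw_def)
      then show ?thesis
        by (simp add: \<tau>_def f_inv_into_f)
    qed
    have \<tau>_less: "\<tau> i < ?L" if "i < ?L" for i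
      using \<tau> that by (auto simp: bij_betw_def)
    have \<tau>_eq: "\<tau> i = \<tau> j \<longleftrightarrow> i = j" if "i < ?L" "j < ?L" for i j
      using \<tau> that by (auto simp: bij_betw_def inj_on_eq_iff)
    have \<sigma>_eq: "\<sigma> x = \<sigma> y \<longleftrightarrow> x = y" if "x \<in> pverts T - {v}" "y \<in> pverts T - {v}" for x y
      using inj that by (rule inj_on_eq_iff)
    have us_mem: "us ! i \<in> pverts T - {v}" if "i < ?L" for i
      using us_v that nth_mem by blast
    \<comment> \<open>Indices in \<open>rest v\<close> start at 1, so \<open>i - 1\<close> is the
      position in \<open>us\<close>, and \<open>Suc\<close> restores the offset.\<close>
    define h where "h = map_sum \<sigma> (\<lambda>(i, g :: 'b). (Suc (\<tau> (i - 1)), g))"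
    have "inj_on h (rest v)"
      by (rule inj_onI) (auto simp: rest_def h_def \<tau>_eq dest: inj_onD[OF inj])
    moreover have "h ` rest v = rest w"
    proof -
      have "h ` Inl ` (pverts T - {v}) = Inl ` \<sigma> ` (pverts T - {v})"
        by (simp add: image_image h_def)
      moreover have "h ` Inr ` (Suc ` {..<?L} \<times> ?R) = Inr ` (Suc ` \<tau> ` {..<?L} \<times> ?R)"
        by (force simp: h_def image_iff)
      ultimately show ?thesis
        using \<tau> img by (simp add: rest_def image_Un bij_betw_def)
    qed
    ultimately have "bij_betw h (set hv) (set hw)"
      by (simp add: bij_betw_def hv hw)
    then show ?thesis
    proof (rule idx_det_char_entry_bij)
      fix x y assume "x \<in> set hv" "y \<in> set hv"
      then show "(h x, h y) \<in> parcs (?C w) \<longleftrightarrow> (x, y) \<in> parcs (?C v)"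
        \<comment> \<open>For arcs between \<open>T\<close> and a copy:
          \<open>\<sigma> x = us ! \<tau> i\<close> is
          \<open>\<sigma> x = \<sigma> (us ! i)\<close>, hence \<open>x = us ! i\<close> by
          injectivity.\<close>
        by (auto simp: hv rest_def h_def in_coal arcs nth_\<tau> \<tau>_less \<tau>_eq \<sigma>_eq[OF _ us_mem])
    qed (use hv hw in auto)
  qed

  have "finite (pverts (?C x))" if "x \<in> pverts T" for x
    using pverts[OF that] fin_rest G.pair_finite_verts by simp
  then show ?thesis
    unfolding cospectral_def
    using v w expand[OF v hv] expand[OF w hw] with_root copy copy_root without_root by simp
qed

section \<open>The path and its periodic attachment vertices\<close>

theorem theorem2:
  fixes k m d p n v w :: nat
    and a :: "nat \<Rightarrow> nat"
    and u :: "nat \<Rightarrow> nat \<Rightarrow> nat"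
    and G :: "'b pair_pre_digraph"
    and r :: 'b
  assumes "k \<ge> 3" and "d \<ge> 2"
    and "1 \<le> m" and "real m < real k / 2"
    and "strict_mono_on {1..p} a" and "\<forall>j\<in>{1..p}. a j \<le> d - 2"
    and "n = k * d - 1" and "v = m * d - 1" and "w = (k - m) * d - 1"
    and "\<forall>i\<in>{1..k}. \<forall>j\<in>{1..p}. u i j = (i - 1) * d + a j"
    and "pair_graph G" and "r \<in> pverts G"
  shows "cospectral
    (coalescence (path_graph n) (v # [u i j. i \<leftarrow> [1..<k + 1], j \<leftarrow> [1..<p + 1]]) G r)
    (coalescence (path_graph n) (w # [u i j. i \<leftarrow> [1..<k + 1], j \<leftarrow> [1..<p + 1]]) G r)"
proof -
  let ?us = "[u i j. i \<leftarrow> [1..<k + 1], j \<leftarrow> [1..<p + 1]]"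
  have m: "m < k"
    using assms(3,4) by linarith
  have v: "Suc v = m * d"
    using assms(2,3,8) by (cases "m * d") auto
  have w: "Suc w = (k - m) * d"
    using assms(2,9) m by (cases "(k - m) * d") auto
  have "k * d = m * d + (k - m) * d"
    using m by (simp flip: add_mult_distrib)
  \<comment> \<open>Deleting \<open>v\<close> leaves paths on \<open>v\<close> and \<open>w\<close>
    vertices, in this order; deleting \<open>w\<close> leaves them in the opposite order.\<close>
  then have n: "n = Suc (v + w)"
    using assms(7) v w by linarith
  have a_less: "Suc (a j) < d" if "j \<in> {1..p}" for j
    using assms(2,6) that by (auto dest!: bspec[of _ _ j])
  \<comment> \<open>The quotient by \<open>d\<close> locates an attachment vertex among the blocks.
    Its residue is never \<open>d - 1\<close>, the residue of \<open>v\<close> and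
    \<open>w\<close>.\<close>
  have block: "q * d + a j < q' * d \<longleftrightarrow> q < q'" "Suc (q * d + a j) \<noteq> q' * d"
    if j: "j \<in> {1..p}" for q q' j
  proof -
    have "q * d + d \<le> q' * d" if "q < q'"
      using mult_le_mono1[of "Suc q" q' d] that by simp
    moreover have "q' * d \<le> q * d" if "\<not> q < q'"
      using that by simp
    ultimately show "q * d + a j < q' * d \<longleftrightarrow> q < q'" "Suc (q * d + a j) \<noteq> q' * d"
      using a_less[OF j] by linarith+
  qed
  have us_eq: "?us = map (\<lambda>(i, j). u i j) (List.product [1..<k + 1] [1..<p + 1])"
    by (simp add: product_concat_map map_concat comp_def del: upt_Suc)
  have ranges: "{1..<k + 1} = {1..k}" "{1..<p + 1} = {1..p}"
    by (simp_all add: atLeastLessThanSuc_atLeastAtMost)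
  have set_us: "set ?us = (\<lambda>(q, j). q * d + a j) ` ({..<k} \<times> {1..p})" (is "_ = ?U")
  proof -
    have "set ?us = (\<lambda>(i, j). u i j) ` ({1..k} \<times> {1..p})"
      unfolding us_eq set_map set_product set_upt ranges ..
    also have "\<dots> = (\<lambda>(i, j). (i - 1) * d + a j) ` ({1..k} \<times> {1..p})"
      by (rule image_cong) (use assms(10) in auto)
    also have "\<dots> = (\<lambda>(q, j). q * d + a j) ` ({..<k} \<times> {1..p})"
    proof -
      have "{1..k} = Suc ` {..<k}"
        by (simp add: image_Suc_lessThan)
      then show ?thesis
        by (force simp: image_iff)
    qed
    finally show ?thesis .
  qed
  have U_pverts: "?U \<subseteq> pverts (path_graph n) - {v, w}"
  proof
    fix x assume "x \<in> ?U"
    then obtain q j where x: "x = q * d + a j" and q: "q < k" and j: "j \<in> {1..p}"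
      by auto
    have "x < k * d" "Suc x \<noteq> k * d" "Suc x \<noteq> m * d" "Suc x \<noteq> (k - m) * d"
      using block[OF j] q by (auto simp: x)
    then show "x \<in> pverts (path_graph n) - {v, w}"
      using assms(7) v w by (auto simp: path_graph_def)
  qed
  have distinct_us: "distinct ?us"
  proof -
    have "inj_on (\<lambda>(i, j). u i j) ({1..k} \<times> {1..p})"
    proof (rule inj_onI, clarify)
      fix i j i' j'
      assume ij: "i \<in> {1..k}" "j \<in> {1..p}" "i' \<in> {1..k}" "j' \<in> {1..p}" and "u i j = u i' j'"
      then have eq: "(i - 1) * d + a j = (i' - 1) * d + a j'"
        using assms(10) by simp
      \<comment> \<open>By \<open>block(1)\<close> the common value lies below the same multiples of
        \<open>d\<close> for both quotients, so these agree.\<close>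
      have "i - 1 = i' - 1"
        using block(1)[OF ij(2)] block(1)[OF ij(4)] eq by (metis less_Suc_eq_le order.antisym order.refl)
      moreover from this have "a j = a j'"
        using eq by simp
      then have "j = j'"
        using assms(5) ij by (metis strict_mono_on_eqD)
      ultimately show "i = i' \<and> j = j'"
        using ij by auto
    qed
    then show ?thesis
      unfolding us_eq distinct_map set_product set_upt ranges by (simp add: distinct_product)
  qed
  \<comment> \<open>Exchanges the segments on either side of the deleted vertex. Adjacent remaining
    vertices lie in one segment and are shifted alike; \<open>w\<close> separates the images of the
    two segments.\<close>
  define \<sigma> where "\<sigma> t = (if t < v then t + Suc w else t - Suc v)" for t
  show ?thesis
  proof (rule cospectral_coalescence_Cons[where \<sigma> = \<sigma>])
    show "pair_graph (path_graph n)"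
      by (rule pair_graph_path_graph)
    show "v \<in> pverts (path_graph n)" "w \<in> pverts (path_graph n)"
      by (auto simp: path_graph_def n)
    show "set ?us \<subseteq> pverts (path_graph n) - {v, w}"
      using U_pverts set_us by simp
    show "bij_betw \<sigma> (pverts (path_graph n) - {v}) (pverts (path_graph n) - {w})"
      by (rule bij_betw_byWitness[where f' = "\<lambda>t. if t < w then t + Suc v else t - Suc w"])
        (auto simp: path_graph_def n \<sigma>_def)
    show "(\<sigma> x, \<sigma> y) \<in> parcs (path_graph n) \<longleftrightarrow> (x, y) \<in> parcs (path_graph n)"
      if "x \<in> pverts (path_graph n) - {v}" "y \<in> pverts (path_graph n) - {v}" for x y
      using that by (auto simp: path_graph_def n \<sigma>_def)
    show "\<sigma> ` set ?us \<subseteq> set ?us"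
      unfolding set_us
    proof (rule image_subsetI)
      fix x assume "x \<in> ?U"
      then obtain q j where x: "x = q * d + a j" and q: "q < k" and j: "j \<in> {1..p}"
        by auto
      have lt: "x < v \<longleftrightarrow> q < m"
        using block[OF j, of q m] v x by linarith
      show "\<sigma> x \<in> ?U"
      \<comment> \<open>The shifts \<open>Suc w = (k - m) * d\<close> and
        \<open>Suc v = m * d\<close> are multiples of \<open>d\<close>: they change the block number
        and keep the offset \<open>a j\<close>.\<close>
      proof (cases "q < m")
        case True
        then have "\<sigma> x = (q + (k - m)) * d + a j" "q + (k - m) < k"
          using lt w m unfolding \<sigma>_def x add_mult_distrib by simp_all
        then show ?thesis
          using j by (intro image_eqI[of _ _ "(q + (k - m), j)"]) simp_all
      next
        case False
        then have "q * d = m * d + (q - m) * d"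
          by (simp flip: add_mult_distrib)
        then have "\<sigma> x = (q - m) * d + a j" "q - m < k"
          using False lt v q by (auto simp: \<sigma>_def x)
        then show ?thesis
          using j by (intro image_eqI[of _ _ "(q - m, j)"]) simp_all
      qed
    qed
  qed (rule assms distinct_us)+
qed

end
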